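(* Let $C$ be a positive integer and $n\geq 1$. Let $\Psi^{C}(p_1,\dots,p_n)$ be the propositional formula defined in the context. For any assignment $I:\{p_1,\dots,p_n\}\to\{0,1\}$ the following are equivalent: (a) $I$ can be extended to an assignment $I'$ of all propositions occurring in $\Psi^{C}(p_1,\dots,p_n)$ such that $I'$ satisfies $\Psi^{C}(p_1,\dots,p_n)$; (b) the $0/1$ sequence $I(p_1),\dots,I(p_n)$ is $C$-bounded.
   Context: A $0/1$ sequence $a_1,\dots,a_n$ is $C$-bounded if for every $1\le j\le n$ the absolute difference between the number of $1$s and the number of $0$s among $a_1,\dots,a_j$ is at most $C$ (equivalently, the $\pm1$ sequence $x_i=2a_i-1$ satisfies $|\sum_{i=1}^j x_i|\le C$ for all $j$). Let $p_1,\dots,p_n$ be propositional variables and let $s^k_j$, $0\le k\le n$, $0\le j\le n$, be further (auxiliary) propositional variables. Let $\Phi(p_1,\dots,p_n)$ be the conjunction of: $s^k_j\leftrightarrow\big(s^k_{j-1}\lor(s^{k-1}_{j-1}\land p_j)\big)$ for all $1\le k\le n$, $1\le j\le n$; $\lnot s^k_j$ for all $0\le j<k\le n$; and $s^0_j$ for all $0\le j\le n$. Let $\Psi^{C}(p_1,\dots,p_n)$ be the conjunction of $\Phi(p_1,\dots,p_n)$ with: $s^k_j$ for all $1\le k\le n$ and $2k-2+C<j\le n$; and $\lnot s^k_j$ for all $1\le k\le n$ and $0\le j<2k-C$. *)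

theory Defs
  imports Main
begin

datatype (atoms: 'v) form =
    Verum
  | Atom 'v
  | Neg "'v form"
  | Conj "'v form" "'v form"
  | Disj "'v form" "'v form"
  | Iff "'v form" "'v form"

primrec eval :: "('v \<Rightarrow> bool) \<Rightarrow> 'v form \<Rightarrow> bool" where
  "eval A Verum \<longleftrightarrow> True"
| "eval A (Atom v) \<longleftrightarrow> A v"
| "eval A (Neg F) \<longleftrightarrow> \<not> eval A F"
| "eval A (Conj F G) \<longleftrightarrow> eval A F \<and> eval A G"
| "eval A (Disj F G) \<longleftrightarrow> eval A F \<or> eval A G"
| "eval A (Iff F G) \<longleftrightarrow> (eval A F \<longleftrightarrow> eval A G)"

text \<open>An assignment of a set of propositions is a partial map whose domain is that set.
  Satisfaction requires every proposition of the formula to be assigned.\<close>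

definition satisfies :: "('v \<rightharpoonup> bool) \<Rightarrow> 'v form \<Rightarrow> bool" where
  "satisfies A F \<longleftrightarrow> atoms F \<subseteq> dom A \<and> eval (\<lambda>v. the (A v)) F"

definition big_conj :: "'v form list \<Rightarrow> 'v form" where
  "big_conj Fs = foldr Conj Fs Verum"

text \<open>\<open>P j\<close> is $p_j$, and \<open>S k j\<close> is $s^k_j$ (upper index first).\<close>

datatype pvar = P nat | S nat nat

definition Phi :: "nat \<Rightarrow> pvar form" where
  "Phi n = Conj
     (big_conj [Iff (Atom (S k j))
                    (Disj (Atom (S k (j - 1))) (Conj (Atom (S (k - 1) (j - 1))) (Atom (P j)))).
                k \<leftarrow> [1..<Suc n], j \<leftarrow> [1..<Suc n]])
     (Conj
       (big_conj [Neg (Atom (S k j)). k \<leftarrow> [0..<Suc n], j \<leftarrow> [0..<k]])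
       (big_conj [Atom (S 0 j). j \<leftarrow> [0..<Suc n]]))"

text \<open>The index \<open>j\<close> always ranges over \<open>{0..n}\<close>, since $s^k_j$ exists only for $j \le n$; in
  particular the range $0 \le j < 2k - C$ of the last conjunct is cut off at \<open>n\<close>. The bounds are
  integers so that no subtraction truncates.\<close>

definition Psi :: "nat \<Rightarrow> nat \<Rightarrow> pvar form" where
  "Psi C n = Conj (Phi n)
     (Conj
       (big_conj [Atom (S k j). k \<leftarrow> [1..<Suc n], j \<leftarrow> [0..<Suc n],
                  2 * int k - 2 + int C < int j])
       (big_conj [Neg (Atom (S k j)). k \<leftarrow> [1..<Suc n], j \<leftarrow> [0..<Suc n],
                  int j < 2 * int k - int C]))"

text \<open>The sequence is $a_1,\dots,a_n$, with \<open>True\<close> for 1 and \<open>False\<close> for 0; the values of \<open>a\<close> outside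
  \<open>{1..n}\<close> play no role.\<close>

definition C_bounded :: "nat \<Rightarrow> nat \<Rightarrow> (nat \<Rightarrow> bool) \<Rightarrow> bool" where
  "C_bounded C n a \<longleftrightarrow>
     (\<forall>j\<in>{1..n}. \<bar>int (card {i \<in> {1..j}. a i}) - int (card {i \<in> {1..j}. \<not> a i})\<bar> \<le> int C)"

end

theory Submission imports Defs begin

text \<open>Under \<open>\<Phi>\<close>, the atom $s^k_j$ is forced to say that at least \<open>k\<close> of $p_1,\dots,p_j$ are true.
  Writing $t_j$ for the number of ones, \<open>C\<close>-boundedness is \<open>\<bar>2 t\<^sub>j - j\<bar> \<le> C\<close>; the two families of
  literals in \<open>\<Psi>\<close> are violated at $k = t_j + 1$ and $k = t_j$ respectively,
  exactly when the lower or the upper bound on \<open>2 t\<^sub>j - j\<close> fails.\<close>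

definition ones :: "(nat \<Rightarrow> bool) \<Rightarrow> nat \<Rightarrow> nat" where
  "ones a j = card {i \<in> {1..j}. a i}"

lemma ones_0 [simp]: "ones a 0 = 0"
  by (simp add: ones_def)

lemma ones_Suc [simp]: "ones a (Suc j) = (if a (Suc j) then Suc (ones a j) else ones a j)"
proof -
  have "{i \<in> {1..Suc j}. a i} =
      (if a (Suc j) then insert (Suc j) {i \<in> {1..j}. a i} else {i \<in> {1..j}. a i})"
    by (auto simp: le_Suc_eq)
  then show ?thesis
    by (simp add: ones_def)
qed

lemma ones_le: "ones a j \<le> j"
  by (induction j) auto

lemma ones_cong: "(\<And>i. i \<in> {1..j} \<Longrightarrow> a i = b i) \<Longrightarrow> ones a j = ones b j"
  unfolding ones_def by (rule arg_cong[where f = card]) auto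

lemma card_zeros: "card {i \<in> {1..j}. \<not> a i} = j - ones a j"
proof -
  have "{i \<in> {1..j}. \<not> a i} = {1..j} - {i \<in> {1..j}. a i}"
    by auto
  then show ?thesis
    by (simp only: ones_def) (subst card_Diff_subset; force)
qed

lemma C_bounded_iff_ones:
  "C_bounded C n a \<longleftrightarrow> (\<forall>j\<in>{1..n}. \<bar>2 * int (ones a j) - int j\<bar> \<le> int C)"
proof -
  \<comment> \<open>\<open>ones_le\<close> ensures that the natural subtraction does not
    truncate.\<close>
  have "int (ones a j) - int (j - ones a j) = 2 * int (ones a j) - int j" for j
    using ones_le[of a j] by simp
  then show ?thesis
    unfolding C_bounded_def card_zeros ones_def[symmetric] by (simp only:)
qed

lemma eval_big_conj [simp]: "eval A (big_conj Fs) \<longleftrightarrow> (\<forall>F\<in>set Fs. eval A F)"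
  by (induction Fs) (auto simp: big_conj_def)

lemma atoms_big_conj [simp]: "atoms (big_conj Fs) = (\<Union>F\<in>set Fs. atoms F)"
  by (induction Fs) (auto simp: big_conj_def)

lemma eval_Phi:
  "eval A (Phi n) \<longleftrightarrow>
     (\<forall>k\<in>{1..n}. \<forall>j\<in>{1..n}. A (S k j) \<longleftrightarrow> A (S k (j - 1)) \<or> A (S (k - 1) (j - 1)) \<and> A (P j)) \<and>
     (\<forall>k\<le>n. \<forall>j<k. \<not> A (S k j)) \<and> (\<forall>j\<le>n. A (S 0 j))"
  unfolding Phi_def
  by (simp add: atLeastLessThanSuc_atLeastAtMost atLeast0AtMost atLeast0LessThan del: upt_Suc)
    (simp add: Ball_def)

lemma eval_Psi:
  "eval A (Psi C n) \<longleftrightarrow> eval A (Phi n) \<and>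
     (\<forall>k\<in>{1..n}. \<forall>j\<le>n. 2 * int k - 2 + int C < int j \<longrightarrow> A (S k j)) \<and>
     (\<forall>k\<in>{1..n}. \<forall>j\<le>n. int j < 2 * int k - int C \<longrightarrow> \<not> A (S k j))"
  unfolding Psi_def
  by (simp add: atLeastLessThanSuc_atLeastAtMost atLeast0AtMost del: upt_Suc)
    (simp add: Ball_def imp_conjL)

text \<open>\<open>P j\<close> occurs in the recurrence for \<open>S k j\<close>, and some such k
  exists since n is at least 1. Hence a valuation cut down to the atoms of \<open>Psi C n\<close>
  can still extend \<open>I\<close>.\<close>

lemma P_in_atoms_Psi:
  assumes "j \<in> {1..n}"
  shows "P j \<in> atoms (Psi C n)"
  using assms by (auto simp: Psi_def Phi_def atLeastLessThanSuc_atLeastAtMost simp del: upt_Suc)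

text \<open>Counting satisfies the same recurrence: there are at least k ones up to j iff there were
  already k before j, or at least k - 1 before j and position j holds a one. The unit literals of
  \<open>Phi\<close> fix the boundary values at j = 0 and k = 0.\<close>

lemma eval_Phi_S_iff:
  assumes "eval A (Phi n)" "k \<le> n" "j \<le> n"
  shows "A (S k j) \<longleftrightarrow> k \<le> ones (\<lambda>i. A (P i)) j"
  using assms(2,3)
proof (induction j arbitrary: k)
  case 0
  with assms(1) show ?case
    by (cases k) (auto simp: eval_Phi)
next
  case (Suc j)
  show ?case
  proof (cases k)
    case 0
    with Suc.prems assms(1) show ?thesis
      by (auto simp: eval_Phi)
  next
    case (Suc k')
    have "A (S k (Suc j)) \<longleftrightarrow> A (S k j) \<or> A (S k' j) \<and> A (P (Suc j))"
      using assms(1) Suc Suc.prems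
      unfolding eval_Phi by (metis One_nat_def Suc_le_mono atLeastAtMost_iff diff_Suc_1 le0)
    with Suc Suc.prems Suc.IH[of k] Suc.IH[of k'] show ?thesis
      by auto
  qed
qed

text \<open>Converse of \<open>eval_Phi_S_iff\<close>: the forced values do form a model, so
  \<open>Phi\<close> puts no constraint on the variables \<open>P j\<close>. This supplies the
  extension of a given assignment.\<close>

lemma eval_Phi_ones:
  assumes "\<And>k j. A (S k j) \<longleftrightarrow> k \<le> ones (\<lambda>i. A (P i)) j"
  shows "eval A (Phi n)"
proof -
  have "A (S k j) \<longleftrightarrow> A (S k (j - 1)) \<or> A (S (k - 1) (j - 1)) \<and> A (P j)"
    if "1 \<le> k" "1 \<le> j" for k j
    using that by (cases j; cases k) (auto simp: assms)
  moreover have "\<not> A (S k j)" if "j < k" for k j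
    using that ones_le[of "\<lambda>i. A (P i)" j] by (simp add: assms)
  ultimately show ?thesis
    by (simp add: eval_Phi assms)
qed

lemma ones_bounds_iff:
  "(\<forall>k\<in>{1..n}. \<forall>j\<le>n. 2 * int k - 2 + int C < int j \<longrightarrow> k \<le> ones a j) \<and>
   (\<forall>k\<in>{1..n}. \<forall>j\<le>n. int j < 2 * int k - int C \<longrightarrow> \<not> k \<le> ones a j) \<longleftrightarrow>
   C_bounded C n a" (is "?lower \<and> ?upper \<longleftrightarrow> _")
proof
  assume bounds: "?lower \<and> ?upper"
  show "C_bounded C n a"
    unfolding C_bounded_iff_ones
  proof
    fix j assume j: "j \<in> {1..n}"
    have "int j - 2 * int (ones a j) \<le> int C"
    proof (rule ccontr)
      assume "\<not> ?thesis"
      \<comment> \<open>The index is in range: j > 2 * \<open>ones a j\<close> + C gives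
        \<open>ones a j\<close> < j, so \<open>Suc (ones a j)\<close> is at most n.\<close>
      with j bounds[THEN conjunct1, rule_format, of "Suc (ones a j)" j] show False
        by auto
    qed
    moreover have "2 * int (ones a j) - int j \<le> int C"
    proof (rule ccontr)
      assume "\<not> ?thesis"
      \<comment> \<open>Here 2 * \<open>ones a j\<close> > j + C > 0 makes the index at least 1, and
        \<open>ones_le\<close> makes it at most n.\<close>
      with j ones_le[of a j] bounds[THEN conjunct2, rule_format, of "ones a j" j] show False
        by auto
    qed
    ultimately show "\<bar>2 * int (ones a j) - int j\<bar> \<le> int C"
      by linarith
  qed
next
  assume bounded: "C_bounded C n a"
  \<comment> \<open>\<open>C_bounded\<close> starts at j = 1, but the literals of \<open>Psi\<close>
    include j = 0, where the difference is 0.\<close>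
  have bound: "\<bar>2 * int (ones a j) - int j\<bar> \<le> int C" if "j \<le> n" for j
    using that bounded by (cases "j = 0") (auto simp: C_bounded_iff_ones)
  show "?lower \<and> ?upper"
  proof (intro conjI ballI allI impI)
    fix k j
    assume "j \<le> n" "2 * int k - 2 + int C < int j"
    with bound[of j] show "k \<le> ones a j"
      by linarith
  next
    fix k j
    assume "j \<le> n" "int j < 2 * int k - int C"
    with bound[of j] show "\<not> k \<le> ones a j"
      by linarith
  qed
qed

lemma eval_Psi_iff:
  "eval A (Psi C n) \<longleftrightarrow> eval A (Phi n) \<and> C_bounded C n (\<lambda>j. A (P j))"
\<comment> \<open>Only under \<open>Phi\<close> may the atoms \<open>S k j\<close> be replaced by
  the counting condition of \<open>ones_bounds_iff\<close>.\<close>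
proof (cases "eval A (Phi n)")
  case True
  then show ?thesis
    unfolding eval_Psi ones_bounds_iff[symmetric]
    by (simp, intro conj_cong ball_cong all_cong refl) (simp_all add: eval_Phi_S_iff)
next
  case False
  then show ?thesis
    by (simp add: eval_Psi)
qed

lemma C_bounded_cong:
  "(\<And>i. i \<in> {1..n} \<Longrightarrow> a i = b i) \<Longrightarrow> C_bounded C n a = C_bounded C n b"
  unfolding C_bounded_iff_ones
proof (intro ball_cong refl)
  fix j
  assume "\<And>i. i \<in> {1..n} \<Longrightarrow> a i = b i" "j \<in> {1..n}"
  then have "ones a j = ones b j"
    by (intro ones_cong) auto
  then show "(\<bar>2 * int (ones a j) - int j\<bar> \<le> int C) = (\<bar>2 * int (ones b j) - int j\<bar> \<le> int C)"
    by simp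
qed

lemma eval_cong: "(\<And>v. v \<in> atoms F \<Longrightarrow> A v = B v) \<Longrightarrow> eval A F = eval B F"
  by (induction F) auto

theorem theorem1:
  fixes C n :: nat and I :: "pvar \<rightharpoonup> bool"
  assumes "C > 0" and "n \<ge> 1"
    and "dom I = P ` {1..n}"
  shows "(\<exists>I'. dom I' = atoms (Psi C n) \<and> I \<subseteq>\<^sub>m I' \<and> satisfies I' (Psi C n))
    \<longleftrightarrow> C_bounded C n (\<lambda>j. the (I (P j)))"
proof
  assume "\<exists>I'. dom I' = atoms (Psi C n) \<and> I \<subseteq>\<^sub>m I' \<and> satisfies I' (Psi C n)"
  then obtain I' where I': "I \<subseteq>\<^sub>m I'" "satisfies I' (Psi C n)"
    by blast
  from I'(2) have "C_bounded C n (\<lambda>j. the (I' (P j)))"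
    by (simp add: satisfies_def eval_Psi_iff)
  moreover have "I (P j) = I' (P j)" if "j \<in> {1..n}" for j
    using that I'(1) assms(3) by (auto simp: map_le_def)
  ultimately show "C_bounded C n (\<lambda>j. the (I (P j)))"
    using C_bounded_cong[of n "\<lambda>j. the (I (P j))" "\<lambda>j. the (I' (P j))"] by simp
next
  assume bounded: "C_bounded C n (\<lambda>j. the (I (P j)))"
  \<comment> \<open>By \<open>eval_Phi_S_iff\<close> these are the only possible values for the
    auxiliary variables. \<open>A\<close> is total; \<open>I'\<close> restricts it to obtain the
    exact domain, which by \<open>eval_cong\<close> leaves the truth value of \<open>Psi C n\<close>
    unchanged.\<close>
  define A where "A v = (case v of P j \<Rightarrow> the (I (P j))
      | S k j \<Rightarrow> k \<le> ones (\<lambda>i. the (I (P i))) j)" for v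
  define I' where "I' v = (if v \<in> atoms (Psi C n) then Some (A v) else None)" for v
  have "eval A (Psi C n)"
    using bounded by (simp add: eval_Psi_iff eval_Phi_ones A_def)
  then have "eval (\<lambda>v. the (I' v)) (Psi C n)"
    by (subst eval_cong[where B = A]) (auto simp: I'_def)
  moreover have "dom I' = atoms (Psi C n)"
    by (auto simp: I'_def dom_def)
  moreover have "I \<subseteq>\<^sub>m I'"
    unfolding map_le_def
  proof
    fix v assume v: "v \<in> dom I"
    then obtain j where "v = P j" "j \<in> {1..n}"
      using assms(3) by auto
    with v show "I v = I' v"
      using P_in_atoms_Psi[of j n C] by (auto simp: I'_def A_def)
  qed
  ultimately show "\<exists>I'. dom I' = atoms (Psi C n) \<and> I \<subseteq>\<^sub>m I' \<and> satisfies I' (Psi C n)"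
    by (auto simp: satisfies_def)
qed

end
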